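(* Let $\mathbb{G}:=\mathbb{C}^{n\times m}\times\mathbb{H}^n$, and define $\tilde\gamma:\mathbb{G}\to\mathbb{R}\cup\{+\infty\}$ by $$\tilde\gamma(X,V):=\begin{cases}\tfrac12\,\mathrm{tr}(X^*V^\dagger X), & \text{if } V\in\mathbb{H}^n_+ \text{ and } \mathrm{rge}\,X\subset\mathrm{rge}\,V,\\ +\infty, & \text{else.}\end{cases}$$ Then $\tilde\gamma$ is a support function; in particular it is closed, proper, and convex.
   Context: $\mathbb{H}^n$ is the real vector space of Hermitian $n\times n$ complex matrices and $\mathbb{H}^n_+$ its positive semidefinite elements. $\mathbb{G}$ is regarded as a real Euclidean space with inner product $\langle (X,U),(Y,V)\rangle=\mathrm{Re}\,\mathrm{tr}(Y^*X)+\mathrm{Re}\,\mathrm{tr}(VU)$. $X^*$ is the conjugate transpose, $V^\dagger$ the Moore–Penrose pseudoinverse, $\mathrm{rge}$ the column space (range). A function $h$ on a Euclidean space $\mathbb{G}$ is a support function if there is a nonempty set $S\subset\mathbb{G}$ with $h(y)=\sup_{x\in S}\langle x,y\rangle$ for all $y\in\mathbb{G}$. Closed means lower semicontinuous. *)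

theory Defs
  imports "HOL-Analysis.Analysis"
begin

text \<open>An \<open>n \<times> m\<close> complex matrix has type \<^typ>\<open>complex^'m^'n\<close>.\<close>

definition ctranspose :: "complex^'m^'n \<Rightarrow> complex^'n^'m" where
  "ctranspose A = (\<chi> i j. cnj (A $ j $ i))"

definition hermitian_mat :: "complex^'n^'n \<Rightarrow> bool" where
  "hermitian_mat A \<longleftrightarrow> ctranspose A = A"

text \<open>For Hermitian \<open>A\<close> the quadratic form \<open>x\<^sup>* A x\<close> is real, so taking the
  real part below loses nothing.\<close>

definition psd_mat :: "complex^'n^'n \<Rightarrow> bool" where
  "psd_mat A \<longleftrightarrow> hermitian_mat A \<and>
     (\<forall>x. 0 \<le> Re (\<Sum>i\<in>UNIV. cnj (x $ i) * (A *v x) $ i))"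

text \<open>The Moore--Penrose pseudoinverse is the unique matrix satisfying the four Penrose equations.\<close>

definition is_pinv :: "complex^'m^'n \<Rightarrow> complex^'n^'m \<Rightarrow> bool" where
  "is_pinv A P \<longleftrightarrow> A ** P ** A = A \<and> P ** A ** P = P \<and>
     hermitian_mat (A ** P) \<and> hermitian_mat (P ** A)"

definition pinv :: "complex^'m^'n \<Rightarrow> complex^'n^'m" where
  "pinv A = (THE P. is_pinv A P)"

definition rge :: "complex^'m^'n \<Rightarrow> (complex^'n) set" where
  "rge A = range ((*v) A)"

text \<open>The space \<open>\<complex>\<^bsup>n\<times>m\<^esup> \<times> \<H>\<^bsup>n\<^esup>\<close> is represented as a real linear subspace
  of a Euclidean space type; \<open>inner_GG\<close> shows that the library inner product restricts to
  \<open>Re tr(Y\<^sup>* X) + Re tr(V U)\<close> on it.\<close>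

definition GG :: "((complex^'m^'n) \<times> (complex^'n^'n)) set" where
  "GG = UNIV \<times> {V. hermitian_mat V}"

lemma inner_mat_eq:
  fixes X Y :: "complex^'m^'n"
  shows "X \<bullet> Y = Re (trace (ctranspose Y ** X))"
proof -
  have "Re (trace (ctranspose Y ** X)) = (\<Sum>j\<in>UNIV. \<Sum>i\<in>UNIV. (X $ i $ j) \<bullet> (Y $ i $ j))"
    by (simp add: trace_def ctranspose_def matrix_matrix_mult_def inner_complex_def mult.commute)
  also have "\<dots> = (\<Sum>i\<in>UNIV. \<Sum>j\<in>UNIV. (X $ i $ j) \<bullet> (Y $ i $ j))"
    by (rule sum.swap)
  finally show ?thesis
    by (simp add: inner_vec_def)
qed

lemma inner_GG:
  assumes "(X, U) \<in> GG" "(Y, V) \<in> GG"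
  shows "(X, U) \<bullet> (Y, V) = Re (trace (ctranspose Y ** X)) + Re (trace (V ** U))"
  using assms by (simp add: GG_def hermitian_mat_def inner_mat_eq)

lemma subspace_GG: "subspace GG"
  unfolding GG_def subspace_def hermitian_mat_def ctranspose_def
  by (auto simp: vec_eq_iff zero_prod_def)

text \<open>Notions for extended-real-valued functions on a Euclidean space \<open>E\<close>, given as a
  linear subspace; values outside \<open>E\<close> are ignored.\<close>

definition support_function_on :: "'a::euclidean_space set \<Rightarrow> ('a \<Rightarrow> ereal) \<Rightarrow> bool" where
  "support_function_on E h \<longleftrightarrow>
     (\<exists>S. S \<noteq> {} \<and> S \<subseteq> E \<and> (\<forall>y\<in>E. h y = (SUP x\<in>S. ereal (x \<bullet> y))))"

definition lsc_on :: "'a::euclidean_space set \<Rightarrow> ('a \<Rightarrow> ereal) \<Rightarrow> bool" where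
  "lsc_on E h \<longleftrightarrow> (\<forall>x\<in>E. h x \<le> Liminf (at x within E) h)"

definition proper_on :: "'a::euclidean_space set \<Rightarrow> ('a \<Rightarrow> ereal) \<Rightarrow> bool" where
  "proper_on E h \<longleftrightarrow> (\<forall>x\<in>E. h x \<noteq> -\<infinity>) \<and> (\<exists>x\<in>E. h x \<noteq> \<infinity>)"

text \<open>The library's \<^const>\<open>convex_on\<close> and \<^const>\<open>epigraph\<close> only cover real-valued functions.\<close>

definition ereal_epigraph :: "'a set \<Rightarrow> ('a \<Rightarrow> ereal) \<Rightarrow> ('a \<times> real) set" where
  "ereal_epigraph E h = {(x, r). x \<in> E \<and> h x \<le> ereal r}"

definition ereal_convex_on :: "'a::euclidean_space set \<Rightarrow> ('a \<Rightarrow> ereal) \<Rightarrow> bool" where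
  "ereal_convex_on E h \<longleftrightarrow> convex (ereal_epigraph E h)"

text \<open>The trace below is real, since the pseudoinverse of a Hermitian matrix is Hermitian;
  \<^const>\<open>Re\<close> only serves as the coercion to the reals.\<close>

definition gamma_tilde :: "(complex^'m^'n) \<times> (complex^'n^'n) \<Rightarrow> ereal" where
  "gamma_tilde = (\<lambda>(X, V).
     if psd_mat V \<and> rge X \<subseteq> rge V
     then ereal (1/2 * Re (trace (ctranspose X ** pinv V ** X)))
     else \<infinity>)"

end

theory Submission
  imports Defs
begin

text \<open>The set \<open>S = {(Y, - Y Y\<^sup>* / 2)}\<close> works: for Hermitian \<open>V\<close>, pairing its elements with
  \<open>(X, V)\<close> gives \<open>Re tr(Y\<^sup>* X) - tr(Y\<^sup>* V Y) / 2\<close>. If \<open>V\<close> is positive semidefinite and \<open>X = V Z\<close>,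
  completing the square shows that the maximum is attained at \<open>Y = Z\<close> and equals
  \<open>tr(Z\<^sup>* V Z) / 2 = tr(X\<^sup>* V\<^sup>\<dagger> X) / 2\<close>. Otherwise it is unbounded along a ray of matrices with a
  single nonzero column \<open>w\<close>: either \<open>w\<^sup>* V w < 0\<close>, or \<open>w\<close> lies in \<open>ker V = (rge V)\<^sup>\<bottom>\<close> and is not
  orthogonal to some column of \<open>X\<close>.\<close>

subsection \<open>Support functions\<close>

text \<open>A strict lower bound on \<open>h x\<close> is witnessed by a single
  \<open>s \<in> S\<close>, and continuity of the linear functional of \<open>s\<close> carries it
  to nearby points.\<close>

lemma support_function_on_lsc:
  assumes "support_function_on E h"
  shows "lsc_on E h"
proof -
  obtain S where S: "\<And>y. y \<in> E \<Longrightarrow> h y = (SUP x\<in>S. ereal (x \<bullet> y))"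
    using assms unfolding support_function_on_def by blast
  have "h x \<le> Liminf (at x within E) h" if "x \<in> E" for x
    unfolding le_Liminf_iff
  proof (intro allI impI)
    fix c assume "c < h x"
    then obtain s where s: "s \<in> S" "c < ereal (s \<bullet> x)"
      using S[OF \<open>x \<in> E\<close>] by (auto simp: less_SUP_iff)
    have "((\<lambda>y. ereal (s \<bullet> y)) \<longlongrightarrow> ereal (s \<bullet> x)) (at x within E)"
      by (intro tendsto_intros)
    then have "\<forall>\<^sub>F y in at x within E. c < ereal (s \<bullet> y)"
      using s(2) by (rule order_tendstoD)
    moreover have "\<forall>\<^sub>F y in at x within E. y \<in> E"
      by (simp add: eventually_at_filter)
    ultimately show "\<forall>\<^sub>F y in at x within E. c < h y"
    proof eventually_elim
      case (elim y)
      then show ?case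
        using S[of y] s(1) by (auto simp: less_SUP_iff)
    qed
  qed
  then show ?thesis
    unfolding lsc_on_def by blast
qed

lemma support_function_on_proper:
  assumes "support_function_on E h" and "0 \<in> E"
  shows "proper_on E h"
proof -
  obtain S where S: "S \<noteq> {}" "\<And>y. y \<in> E \<Longrightarrow> h y = (SUP x\<in>S. ereal (x \<bullet> y))"
    using assms(1) unfolding support_function_on_def by blast
  obtain s where "s \<in> S"
    using S(1) by blast
  then have "ereal (s \<bullet> y) \<le> h y" if "y \<in> E" for y
    using S(2)[OF that] by (auto intro: SUP_upper)
  then have "\<forall>y\<in>E. h y \<noteq> -\<infinity>"
    by fastforce
  \<comment> \<open>At the origin every linear functional vanishes, so the supremum is 0.\<close>
  moreover have "h 0 \<noteq> \<infinity>"
    using S(2)[OF assms(2)] S(1) by simp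
  ultimately show ?thesis
    using assms(2) unfolding proper_on_def by blast
qed

lemma support_function_on_convex:
  assumes "support_function_on E h" and "convex E"
  shows "ereal_convex_on E h"
proof -
  obtain S where S: "\<And>y. y \<in> E \<Longrightarrow> h y = (SUP x\<in>S. ereal (x \<bullet> y))"
    using assms(1) unfolding support_function_on_def by blast
  \<comment> \<open>The condition \<open>s \<bullet> y \<le> r\<close> describes a half-space of
    pairs \<open>(y, r)\<close> with normal \<open>(s, - 1)\<close>.\<close>
  have "ereal_epigraph E h = (E \<times> UNIV) \<inter> (\<Inter>s\<in>S. {p. (s, - 1) \<bullet> p \<le> 0})"
    unfolding ereal_epigraph_def using S by (auto simp: SUP_le_iff)
  moreover have "convex \<dots>"
    by (intro convex_Int convex_Times convex_INT convex_halfspace_le assms convex_UNIV)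
  ultimately show ?thesis
    unfolding ereal_convex_on_def by simp
qed

subsection \<open>Complex matrices\<close>

lemma ctranspose_mult: "ctranspose (A ** B) = ctranspose B ** ctranspose A"
  by (simp add: ctranspose_def matrix_matrix_mult_def vec_eq_iff mult.commute)

lemma ctranspose_ctranspose [simp]: "ctranspose (ctranspose A) = A"
  by (simp add: ctranspose_def vec_eq_iff)

lemma inner_matrix_mult_left: "(A ** B) \<bullet> C = B \<bullet> (ctranspose A ** C)"
  by (simp add: inner_mat_eq ctranspose_mult matrix_mul_assoc)

text \<open>Cyclicity of the trace turns the pairing with \<open>V\<close> into a quadratic form in
  \<open>Y\<close>.\<close>

lemma inner_mult_ctranspose:
  fixes Y :: "complex^'m^'n"
  assumes "hermitian_mat V"
  shows "(Y ** ctranspose Y) \<bullet> V = (V ** Y) \<bullet> Y"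
  using assms trace_mul_sym[of "V ** Y" "ctranspose Y"]
  by (simp add: inner_mat_eq hermitian_mat_def matrix_mul_assoc)

lemma column_matrix_mult: "column j (A ** B) = A *v column j B"
  by (simp add: column_def matrix_matrix_mult_def matrix_vector_mult_def vec_eq_iff)

lemma inner_eq_sum_column:
  fixes A B :: "complex^'m^'n"
  shows "A \<bullet> B = (\<Sum>j\<in>UNIV. column j A \<bullet> column j B)"
  unfolding inner_vec_def column_def by (simp add: inner_vec_def) (rule sum.swap)

lemma matrix_eq_iff_column: "A = B \<longleftrightarrow> (\<forall>j. column j A = column j B)"
  by (auto simp: column_def vec_eq_iff)

lemma inner_matrix_vector_left:
  fixes A :: "complex^'m^'n"
  shows "(A *v x) \<bullet> y = x \<bullet> (ctranspose A *v y)"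
proof -
  have adj: "(a * b) \<bullet> c = b \<bullet> (cnj a * c)" for a b c :: complex
    by (simp add: inner_complex_def algebra_simps)
  have "(A *v x) \<bullet> y = (\<Sum>i\<in>UNIV. \<Sum>j\<in>UNIV. (A $ i $ j * x $ j) \<bullet> (y $ i))"
    by (simp add: inner_vec_def matrix_vector_mult_def inner_sum_left)
  also have "\<dots> = (\<Sum>j\<in>UNIV. \<Sum>i\<in>UNIV. (A $ i $ j * x $ j) \<bullet> (y $ i))"
    by (rule sum.swap)
  also have "\<dots> = x \<bullet> (ctranspose A *v y)"
    by (simp add: inner_vec_def matrix_vector_mult_def inner_sum_right ctranspose_def adj)
  finally show ?thesis .
qed

text \<open>Preimages of the columns of \<open>X\<close> under \<open>V\<close> are assembled as the
  columns of \<open>Z\<close>.\<close>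

lemma matrix_factor_through_columns:
  fixes X :: "complex^'m^'n" and V :: "complex^'k^'n"
  assumes "\<And>j. column j X \<in> rge V"
  obtains Z where "X = V ** Z"
proof -
  have "\<exists>z. column j X = V *v z" for j
    using assms[of j] unfolding rge_def by blast
  then obtain z where z: "\<And>j. column j X = V *v z j"
    by metis
  have "column j (\<chi> i j. z j $ i) = z j" for j
    by (simp add: column_def vec_eq_iff)
  then have "X = V ** (\<chi> i j. z j $ i)"
    by (simp add: matrix_eq_iff_column column_matrix_mult z)
  then show thesis
    by (rule that)
qed

lemma column_in_rge: "column j X \<in> rge X"
proof -
  have "column j X = X *v axis j 1"
    by (simp add: column_def axis_def matrix_vector_mult_def vec_eq_iff if_distrib cong: if_cong)
  then show ?thesis
    by (auto simp: rge_def)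
qed

lemma rge_mult_subset: "rge (V ** Z) \<subseteq> rge V"
  by (auto simp: rge_def simp flip: matrix_vector_mul_assoc)

lemma psd_mat_iff_inner:
  "psd_mat V \<longleftrightarrow> hermitian_mat V \<and> (\<forall>x. 0 \<le> (V *v x) \<bullet> x)"
  unfolding psd_mat_def inner_vec_def by (simp add: inner_complex_def mult.commute)

lemma psd_mat_inner_mult_nonneg:
  fixes Y :: "complex^'m^'n"
  assumes "psd_mat V"
  shows "0 \<le> (V ** Y) \<bullet> Y"
  using assms by (auto simp: inner_eq_sum_column column_matrix_mult psd_mat_iff_inner intro: sum_nonneg)

text \<open>The witness \<open>w\<close> is the component of \<open>x\<close> orthogonal to
  \<open>rge V\<close>, so \<open>w \<bullet> x\<close> is its squared norm.\<close>

lemma hermitian_kernel_separates: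
  assumes "hermitian_mat V" and "x \<notin> rge V"
  obtains w where "V *v w = 0" "w \<bullet> x > 0"
proof -
  have sub: "subspace (rge V)"
    unfolding rge_def by (intro linear_subspace_image matrix_vector_mul_linear subspace_UNIV)
  obtain y w where y: "y \<in> span (rge V)" and w: "\<And>v. v \<in> span (rge V) \<Longrightarrow> orthogonal w v"
    and x: "x = y + w"
    using orthogonal_subspace_decomp_exists[of "rge V" x] by metis
  have "y \<in> rge V"
    using y sub by (simp add: span_eq_iff[THEN iffD2])
  then have "w \<noteq> 0"
    using assms(2) x by auto
  have "V *v w = 0"
  proof -
    \<comment> \<open>Moving \<open>V\<close> across the inner product pairs \<open>w\<close> with a
      point of \<open>rge V\<close>, so the squared norm of \<open>V *v w\<close> is 0.\<close>
    have "(V *v w) \<bullet> (V *v w) = w \<bullet> (V *v (V *v w))"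
      using assms(1) by (subst inner_matrix_vector_left) (simp add: hermitian_mat_def)
    also have "\<dots> = 0"
      using w[OF span_base] by (auto simp: rge_def orthogonal_def)
    finally show ?thesis
      by simp
  qed
  moreover have "w \<bullet> x > 0"
    using w[OF y] \<open>w \<noteq> 0\<close> by (simp add: x inner_add_right orthogonal_def)
  ultimately show thesis
    by (rule that)
qed

subsection \<open>The pseudoinverse of a Hermitian matrix\<close>

lemma is_pinv_unique:
  assumes "is_pinv A P" "is_pinv A Q"
  shows "P = Q"
proof -
  note pinv = assms[unfolded is_pinv_def hermitian_mat_def]
  \<comment> \<open>Taking adjoints of the Hermitian factors swaps them: \<open>A Q A P\<close>
    equals \<open>A P\<close>, while \<open>A P A Q\<close> equals \<open>A Q\<close>.\<close>
  have "A ** P = ctranspose ((A ** P) ** (A ** Q))"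
    using pinv by (metis ctranspose_mult matrix_mul_assoc)
  also have "\<dots> = A ** Q"
    using pinv by (metis matrix_mul_assoc)
  finally have left: "A ** P = A ** Q" .
  have "P ** A = ctranspose ((Q ** A) ** (P ** A))"
    using pinv by (metis ctranspose_mult matrix_mul_assoc)
  also have "\<dots> = Q ** A"
    using pinv by (metis matrix_mul_assoc)
  finally have "P ** A = Q ** A" .
  \<comment> \<open>Now \<open>P = P A P = P A Q = Q A Q = Q\<close>.\<close>
  then show ?thesis
    using pinv left by (metis matrix_mul_assoc)
qed

text \<open>The kernels of \<open>V ** V\<close> and \<open>V\<close> agree, since the squared norm
  of \<open>V *v w\<close> is \<open>w \<bullet> (V *v (V *v w))\<close>. A vector separating a
  point of \<open>rge V\<close> from \<open>rge (V ** V)\<close> would then be orthogonal to that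
  point.\<close>

lemma hermitian_rge_square:
  assumes "hermitian_mat V"
  shows "rge V \<subseteq> rge (V ** V)"
proof
  fix x assume "x \<in> rge V"
  then obtain y where y: "x = V *v y"
    by (auto simp: rge_def)
  have adj: "(V *v u) \<bullet> v = u \<bullet> (V *v v)" for u v
    using inner_matrix_vector_left[of V u v] assms by (simp add: hermitian_mat_def)
  show "x \<in> rge (V ** V)"
  proof (rule ccontr)
    assume notin: "x \<notin> rge (V ** V)"
    have "hermitian_mat (V ** V)"
      using assms by (simp add: hermitian_mat_def ctranspose_mult)
    then obtain w where w: "(V ** V) *v w = 0" "w \<bullet> x > 0"
      using notin by (rule hermitian_kernel_separates)
    have "(V *v w) \<bullet> (V *v w) = 0"
      using w(1) by (simp add: adj matrix_vector_mul_assoc)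
    then have "V *v w = 0"
      by (simp only: inner_eq_zero_iff)
    then have "w \<bullet> x = 0"
      using adj[of w y] by (simp add: y)
    with w(2) show False
      by simp
  qed
qed

text \<open>Writing \<open>V = V\<^sup>2 W\<close>, the matrix \<open>V W\<close> is the orthogonal projection onto the range of \<open>V\<close>, and
  \<open>W\<^sup>* V W\<close> is the pseudoinverse.\<close>

lemma hermitian_is_pinv_pinv:
  fixes V :: "complex^'n^'n"
  assumes "hermitian_mat V"
  shows "is_pinv V (pinv V)"
proof -
  have H: "ctranspose V = V"
    using assms by (simp add: hermitian_mat_def)
  obtain W where W: "V = V ** V ** W"
    using hermitian_rge_square[OF assms] column_in_rge
    by (metis matrix_factor_through_columns subsetD)
  define E where "E = V ** W"
  have VE: "V ** E = V"
    using W by (simp add: E_def matrix_mul_assoc)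
  have EV': "ctranspose E ** V = V"
    using arg_cong[OF VE, of ctranspose] by (simp add: ctranspose_mult H)
  have E: "ctranspose E = ctranspose W ** V"
    by (simp add: E_def ctranspose_mult H)
  \<comment> \<open>Replacing \<open>V\<close> by \<open>ctranspose E ** V\<close> in
    \<open>V ** W\<close> exhibits \<open>E\<close> as a Gram matrix, hence Hermitian.\<close>
  have "E = ctranspose E ** E"
    using EV' by (metis E_def matrix_mul_assoc)
  then have EH: "ctranspose E = E"
    by (metis ctranspose_mult ctranspose_ctranspose)
  define P where "P = ctranspose W ** V ** W"
  have PE: "P = E ** W"
    using E EH by (simp add: P_def)
  have VP: "V ** P = E"
    using VE by (simp add: PE matrix_mul_assoc flip: E_def)
  have PV: "P ** V = E"
    by (metis E E_def EH EV' P_def matrix_mul_assoc)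
  have "is_pinv V P"
    unfolding is_pinv_def hermitian_mat_def
  proof (intro conjI)
    show "V ** P ** V = V"
      using VP EV' EH by simp
    show "P ** V ** P = P"
      using PV PE \<open>E = ctranspose E ** E\<close> EH by (metis matrix_mul_assoc)
  qed (simp_all add: VP PV EH)
  then show ?thesis
    unfolding pinv_def by (rule theI) (rule is_pinv_unique[OF _ \<open>is_pinv V P\<close>])
qed

subsection \<open>The support function representation\<close>

definition gamma_generator :: "complex^'m^'n \<Rightarrow> (complex^'m^'n) \<times> (complex^'n^'n)" where
  "gamma_generator Y = (Y, - (1/2) *\<^sub>R (Y ** ctranspose Y))"

lemma gamma_generator_in_GG:
  fixes Y :: "complex^'m^'n"
  shows "gamma_generator Y \<in> GG"
proof -
  have "ctranspose (- (r *\<^sub>R A)) = - (r *\<^sub>R ctranspose A)" for r and A :: "complex^'n^'n"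
    by (simp add: ctranspose_def vec_eq_iff)
  then show ?thesis
    by (simp add: gamma_generator_def GG_def hermitian_mat_def ctranspose_mult)
qed

lemma inner_gamma_generator:
  assumes "hermitian_mat V"
  shows "gamma_generator Y \<bullet> (X, V) = Y \<bullet> X - (V ** Y) \<bullet> Y / 2"
  using inner_mult_ctranspose[OF assms, of Y] by (simp add: gamma_generator_def)

text \<open>The Penrose equation \<open>V ** pinv V ** V = V\<close> removes the pseudoinverse from
  the trace.\<close>

lemma gamma_tilde_factor:
  assumes "psd_mat V"
  shows "gamma_tilde (V ** Z, V) = ereal ((V ** Z) \<bullet> Z / 2)"
proof -
  have H: "ctranspose V = V" and pinv: "V ** pinv V ** V = V"
    using assms hermitian_is_pinv_pinv[of V]
    by (auto simp: psd_mat_def hermitian_mat_def is_pinv_def)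
  have "ctranspose (V ** Z) ** pinv V ** (V ** Z) = ctranspose Z ** (V ** pinv V ** V) ** Z"
    by (simp only: ctranspose_mult H matrix_mul_assoc)
  then have "ctranspose (V ** Z) ** pinv V ** (V ** Z) = ctranspose Z ** (V ** Z)"
    by (simp add: pinv matrix_mul_assoc)
  then show ?thesis
    using assms rge_mult_subset[of V Z] by (simp add: gamma_tilde_def inner_mat_eq)
qed

text \<open>The right side exceeds the left by half the quadratic form of \<open>V\<close> at
  \<open>Y - Z\<close>.\<close>

lemma gamma_generator_le:
  assumes "psd_mat V"
  shows "gamma_generator Y \<bullet> (V ** Z, V) \<le> gamma_generator Z \<bullet> (V ** Z, V)"
proof -
  have H: "hermitian_mat V"
    using assms by (simp add: psd_mat_def)
  have "(V ** Z) \<bullet> Y = Z \<bullet> (V ** Y)"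
    using H by (simp add: inner_matrix_mult_left hermitian_mat_def)
  moreover have "0 \<le> (V ** (Y - Z)) \<bullet> (Y - Z)"
    using assms by (rule psd_mat_inner_mult_nonneg)
  moreover have "V ** (Y - Z) = V ** Y - V ** Z"
    by (simp add: matrix_matrix_mult_def vec_eq_iff right_diff_distrib sum_subtractf)
  ultimately show ?thesis
    by (simp add: inner_gamma_generator[OF H] inner_diff_left inner_diff_right
        inner_commute)
qed

lemma gamma_generator_unbounded:
  fixes X :: "complex^'m^'n"
  assumes "hermitian_mat V"
    and w: "(V *v w) \<bullet> w < 0 \<or> (V *v w) \<bullet> w = 0 \<and> w \<bullet> column j X > 0"
  shows "\<exists>Y. B \<le> gamma_generator Y \<bullet> (X, V)"
proof -
  define a where "a = w \<bullet> column j X"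
  define q where "q = (V *v w) \<bullet> w"
  define Y where "Y t = (\<chi> i k. if k = j then t *\<^sub>R w $ i else 0)" for t
  have col: "column k (Y t) = (if k = j then t *\<^sub>R w else 0)" for k t
    by (simp add: column_def Y_def vec_eq_iff)
  have "Y t \<bullet> X = t * a" for t
    by (simp add: inner_eq_sum_column col a_def if_distrib[of "\<lambda>x. x \<bullet> _"] cong: if_cong)
  moreover have "(V ** Y t) \<bullet> Y t = t\<^sup>2 * q" for t
    by (simp add: inner_eq_sum_column col column_matrix_mult q_def if_distrib[of "\<lambda>x. _ \<bullet> x"]
        linear_cmul[OF matrix_vector_mul_linear] power2_eq_square cong: if_cong)
  ultimately have val: "gamma_generator (Y t) \<bullet> (X, V) = t * a - t\<^sup>2 * q / 2" for t
    by (simp add: inner_gamma_generator[OF assms(1)])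
  have "\<exists>t. B \<le> t * a - t\<^sup>2 * q / 2"
  proof (cases "q < 0")
    case True
    \<comment> \<open>As \<open>r \<ge> 1\<close>, the term \<open>r\<^sup>2 * (- q)\<close> is at
      least \<open>r * (- q) = 2 * \<bar>B\<bar> - q\<close>, so the quadratic part alone reaches
      \<open>B\<close>.\<close>
    define r where "r = 1 + 2 * \<bar>B\<bar> / (- q)"
    have "r \<ge> 1"
      using True by (simp add: r_def divide_nonneg_neg)
    then have "r \<le> r\<^sup>2"
      by (simp add: power2_eq_square)
    then have "r * (- q) \<le> r\<^sup>2 * (- q)"
      using True by (intro mult_right_mono) auto
    moreover have "r * (- q) = 2 * \<bar>B\<bar> - q"
      using True by (simp add: r_def field_simps)
    ultimately have "B \<le> - (r\<^sup>2 * q / 2)"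
      using True by linarith
    \<comment> \<open>The sign of \<open>a\<close> is unknown; one of \<open>r\<close> and
      \<open>- r\<close> makes the linear part nonnegative, and both give the same quadratic
      part.\<close>
    moreover have "0 \<le> r * a \<or> 0 \<le> - r * a"
      by auto
    ultimately have "B \<le> r * a - r\<^sup>2 * q / 2 \<or> B \<le> (- r) * a - (- r)\<^sup>2 * q / 2"
      by auto
    then show ?thesis
      by blast
  next
    case False
    then have "q = 0" "a > 0"
      using w by (auto simp: q_def a_def)
    \<comment> \<open>Without a quadratic part the value is \<open>t * a\<close>, which equals
      \<open>B\<close> at \<open>t = B / a\<close>.\<close>
    then have "B \<le> (B / a) * a - (B / a)\<^sup>2 * q / 2"
      by simp
    then show ?thesis ..
  qed
  then show ?thesis
    using val by metis
qed

lemma gamma_tilde_eq_SUP: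
  fixes X :: "complex^'m^'n"
  assumes "hermitian_mat V"
  shows "gamma_tilde (X, V) = (SUP Y. ereal (gamma_generator Y \<bullet> (X, V)))"
proof (cases "psd_mat V \<and> rge X \<subseteq> rge V")
  case True
  then obtain Z where Z: "X = V ** Z"
    using column_in_rge by (metis matrix_factor_through_columns subsetD)
  have "(SUP Y. ereal (gamma_generator Y \<bullet> (X, V))) = ereal (gamma_generator Z \<bullet> (X, V))"
    using True by (intro antisym SUP_least SUP_upper) (simp_all add: Z gamma_generator_le)
  then show ?thesis
    using True by (simp add: Z gamma_tilde_factor inner_gamma_generator[OF assms] inner_commute)
next
  case False
  have "\<exists>w j. (V *v w) \<bullet> w < 0 \<or> (V *v w) \<bullet> w = 0 \<and> w \<bullet> column j X > 0"
  proof (cases "psd_mat V")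
    case True
    \<comment> \<open>If all columns lay in \<open>rge V\<close>, then \<open>X\<close> would factor
      through \<open>V\<close> and its range would be contained in \<open>rge V\<close>.\<close>
    then have "\<exists>j. column j X \<notin> rge V"
      using False rge_mult_subset by (metis matrix_factor_through_columns)
    then show ?thesis
      using assms by (metis hermitian_kernel_separates inner_zero_left)
  next
    case False
    then show ?thesis
      using assms by (auto simp: psd_mat_iff_inner not_le)
  qed
  then have "\<exists>Y. B \<le> gamma_generator Y \<bullet> (X, V)" for B
    using gamma_generator_unbounded[OF assms] by metis
  then have "(SUP Y. ereal (gamma_generator Y \<bullet> (X, V))) = \<infinity>"
    by (intro SUP_PInfty) auto
  then show ?thesis
    using False by (auto simp: gamma_tilde_def)
qed

theorem proposition27:
  shows "support_function_on GG (gamma_tilde :: (complex^'m^'n) \<times> (complex^'n^'n) \<Rightarrow> ereal)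
    \<and> lsc_on GG (gamma_tilde :: (complex^'m^'n) \<times> (complex^'n^'n) \<Rightarrow> ereal)
    \<and> proper_on GG (gamma_tilde :: (complex^'m^'n) \<times> (complex^'n^'n) \<Rightarrow> ereal)
    \<and> ereal_convex_on GG (gamma_tilde :: (complex^'m^'n) \<times> (complex^'n^'n) \<Rightarrow> ereal)"
proof -
  have "support_function_on GG (gamma_tilde :: (complex^'m^'n) \<times> (complex^'n^'n) \<Rightarrow> ereal)"
    unfolding support_function_on_def
  proof (intro exI[of _ "range gamma_generator"] conjI ballI)
    fix p :: "(complex^'m^'n) \<times> (complex^'n^'n)"
    assume "p \<in> GG"
    then obtain X V where "p = (X, V)" "hermitian_mat V"
      by (auto simp: GG_def)
    then show "gamma_tilde p = (SUP x\<in>range gamma_generator. ereal (x \<bullet> p))"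
      by (simp add: gamma_tilde_eq_SUP image_comp o_def)
  qed (auto simp: gamma_generator_in_GG)
  \<comment> \<open>Being a subspace, \<open>GG\<close> contains 0 and is convex, as properness and
    convexity of the epigraph require.\<close>
  then show ?thesis
    using support_function_on_lsc support_function_on_proper support_function_on_convex
      subspace_0[OF subspace_GG] subspace_imp_convex[OF subspace_GG]
    by blast
qed

end
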